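(* Let $V\hookrightarrow X\hookrightarrow V'$ be a Hilbert triple, $Y$ a Hilbert space, and $A:X\to Y$ a bounded linear operator whose adjoint $A^*$ maps $Y$ boundedly into $V$. Let $\mu\in V'$, let $y\in Y$, and let $x^*\in V$ satisfy $A x^*=y$. Let $Y_h=\mathrm{Span}\{y_j\}_{j=1}^N\subset Y$ be a finite-dimensional subspace, $P_h:Y\to Y_h$ the orthogonal projector onto $Y_h$, and let $$X_h:=A^*Y_h=\mathrm{Span}\{x_j\}_{j=1}^N\subset V,$$ where $\det\big(\langle A^*P_h^* y_i,x_j\rangle_X\big)_{1\le i,j\le N}\neq 0$. Let $\varphi_h\in Y_h$ be the solution of $$\langle A^*\varphi_h-\mu,\,w\rangle_X=0\qquad\text{for all } w\in X_h .$$ For $\epsilon>0$ and $y_\epsilon\in Y$ with $\|y-y_\epsilon\|_Y\le\epsilon$ set $$f:=\langle\mu,x^*\rangle_X,\qquad f_{\epsilon,\varphi,h}:=\langle\varphi_h,P_h y_\epsilon\rangle_Y .$$ Then $$|f-f_{\epsilon,\varphi,h}|\le \mathrm{dist}(\mu,A^*Y_h)_{V'}\,\big(1+\|\mathcal P_h\|\big)\,\mathrm{dist}(x^*,X_h)_V+O(\epsilon),$$ where $\mathcal P_h:X\to X_h$ is the $X$-orthogonal projector onto $X_h$, and $O(\epsilon)$ means: there is a constant $C\geq 0$, independent of $\epsilon$ and $y_\epsilon$, such that the inequality holds with $O(\epsilon)$ replaced by $C\epsilon$.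
   Context: A Hilbert triple $V\hookrightarrow X\hookrightarrow V'$ consists of Hilbert spaces $V$ and $X$ with $V$ continuously and densely embedded in $X$; $X$ is identified with its dual $X'$, and hence embedded in the dual $V'$ of $V$. The space $Y$ is identified with its dual $Y'$. The symbol $\langle\cdot,\cdot\rangle_Y$ is the inner product of $Y$. The symbol $\langle\cdot,\cdot\rangle_X$ denotes the inner product of $X$ and also its extension to the duality pairing between $V'$ and $V$. For a subspace $S$ of a normed space $Z$, $\mathrm{dist}(z,S)_Z=\inf_{s\in S}\|z-s\|_Z$; in $\mathrm{dist}(\mu,A^*Y_h)_{V'}$ the space $A^*Y_h$ is regarded as a subspace of $V'$ via $V\hookrightarrow X\hookrightarrow V'$. The quantity $\|\mathcal P_h\|$ is the operator norm of the restriction of $\mathcal P_h$ to $V$, regarded as an operator $(V,\|\cdot\|_V)\to (X_h,\|\cdot\|_V)$. *)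

theory Defs
  imports "HOL-Analysis.Analysis"
begin

(* The Hilbert spaces V, X, Y are types of sort {real_inner, complete_space}, and V' is the
   Banach space 'v =>\<^sub>L real. The embedding of V into X is an explicit map j, because V and X
   carry different norms. *)

definition hilbert_triple ::
  "('v::{real_inner,complete_space} \<Rightarrow>\<^sub>L 'x::{real_inner,complete_space}) \<Rightarrow> bool" where
  "hilbert_triple j \<longleftrightarrow>
     inj (blinfun_apply j) \<and> closure (range (blinfun_apply j)) = UNIV"

(* The embedding X = X' into V': x is sent to v |-> <x, j v>. *)

definition to_dual ::
  "('v::real_inner \<Rightarrow>\<^sub>L 'x::real_inner) \<Rightarrow> 'x \<Rightarrow> ('v \<Rightarrow>\<^sub>L real)" where
  "to_dual j x = blinfun_inner_right x o\<^sub>L j"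

lemma to_dual_apply [simp]: "blinfun_apply (to_dual j x) v = x \<bullet> blinfun_apply j v"
  by (simp add: to_dual_def)

(* Meaningful for complete (in particular finite-dimensional) subspaces S, where the point p exists. *)

definition orth_proj :: "'a::real_inner set \<Rightarrow> 'a \<Rightarrow> 'a" where
  "orth_proj S z = (THE p. p \<in> S \<and> (\<forall>s\<in>S. orthogonal (z - p) s))"

lemma orth_proj_eqI:
  assumes "subspace S" "p \<in> S" "\<And>s. s \<in> S \<Longrightarrow> orthogonal (z - p) s"
  shows "orth_proj S z = p"
  unfolding orth_proj_def
proof (rule the_equality)
  show "p \<in> S \<and> (\<forall>s\<in>S. orthogonal (z - p) s)"
    using assms by blast
  fix q assume q: "q \<in> S \<and> (\<forall>s\<in>S. orthogonal (z - q) s)"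
  have "p - q \<in> S"
    using assms q by (simp add: subspace_diff)
  then have "(z - q) \<bullet> (p - q) = 0" "(z - p) \<bullet> (p - q) = 0"
    using assms q by (auto simp: orthogonal_def)
  then have "(p - q) \<bullet> (p - q) = 0"
    by (simp add: inner_diff_left)
  then show "q = p" by simp
qed

(* The restriction to V of an operator P on X with P (j v) in range j for all v, as an operator
   on V, so that onorm measures its argument and its value in the norm of V. *)

definition restrict_to_V ::
  "('v::real_normed_vector \<Rightarrow>\<^sub>L 'x::real_normed_vector) \<Rightarrow> ('x \<Rightarrow> 'x) \<Rightarrow> 'v \<Rightarrow> 'v" where
  "restrict_to_V j P v = inv (blinfun_apply j) (P (blinfun_apply j v))"

end

(* Write \<mu>h for the image of \<phi>h in V', P for the X-orthogonal projector restricted to V, and e = x* - w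
   with w in Xh. By the Galerkin equation \<mu> - \<mu>h annihilates Xh, so (\<mu> - \<mu>h) x* = (\<mu> - \<mu>h) (e - P e).
   Since e - P e is X-orthogonal to Xh = A* Yh, \<mu>h may be replaced here by any other element of A* Yh;
   taking infima gives the product of distances. The noise contributes at most |\<phi>h| \<epsilon>.
   Existence of \<open>adjoint\<close>, a Hilbert choice, needs the Riesz representation theorem. *)

theory Submission
  imports Defs
begin

text \<open>For \<open>K > 0\<close> divide by \<open>K\<close> and take the infimum; for
  \<open>K = 0\<close> test a single point. Nonemptiness matters: \<open>infdist\<close> to the
  empty set is 0 by convention.\<close>

lemma le_mult_infdist:
  assumes "A \<noteq> {}" "0 \<le> K" "\<And>a. a \<in> A \<Longrightarrow> c \<le> K * dist x a"
  shows "c \<le> K * infdist x A"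
proof (cases "K = 0")
  case True
  then show ?thesis using assms by auto
next
  case False
  with assms have "0 < K" by simp
  then have "c / K \<le> infdist x A"
    unfolding infdist_notempty[OF assms(1)] using assms
    by (intro cINF_greatest) (auto simp: divide_le_eq mult.commute)
  then show ?thesis
    using \<open>0 < K\<close> by (simp add: divide_le_eq mult.commute)
qed

section \<open>Riesz representation and adjoints\<close>

lemma linear_coeff_eq_0:
  fixes a b :: real
  assumes "\<And>t. 0 \<le> a * t\<^sup>2 + b * t" "0 \<le> a"
  shows "b = 0"
proof (rule ccontr)
  assume "b \<noteq> 0"
  \<comment> \<open>The shift by one keeps \<open>d\<close> positive even for \<open>a = 0\<close>;
    at \<open>t = - b / d\<close> the quadratic equals \<open>- (b / d)\<^sup>2\<close>.\<close>
  define d where "d = a + 1"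
  then have "0 < d" and a: "a = d - 1" using assms(2) by auto
  have "0 \<le> a * (- b / d)\<^sup>2 + b * (- b / d)" by (rule assms)
  also have "\<dots> = - (b / d)\<^sup>2"
    unfolding a using \<open>0 < d\<close> by (simp add: field_simps power2_eq_square)
  finally have "(b / d)\<^sup>2 \<le> 0" by simp
  then show False using \<open>b \<noteq> 0\<close> \<open>0 < d\<close> by simp
qed

text \<open>The parallelogram law makes a minimising sequence of \<open>E\<close> Cauchy,
  completeness supplies a minimiser \<open>u\<close>, and the vanishing first variation at
  \<open>u\<close> says that \<open>u\<close> represents \<open>f\<close>.\<close>

theorem riesz_representation:
  fixes f :: "'a::{real_inner,complete_space} \<Rightarrow> real"
  assumes f: "bounded_linear f"
  obtains u where "\<And>x. f x = x \<bullet> u"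
proof -
  interpret f: bounded_linear f by (rule f)
  \<comment> \<open>the energy minimised by the representing vector\<close>
  define E where "E x = x \<bullet> x - 2 * f x" for x
  obtain K where K: "\<And>x. norm (f x) \<le> norm x * K"
    using f.bounded by blast
  have lower: "- (K\<^sup>2) \<le> E x" for x
  proof -
    have "f x \<le> norm x * K" using K[of x] by simp
    \<comment> \<open>Completing the square: \<open>E x\<close> is at least
      \<open>(norm x - K)\<^sup>2 - K\<^sup>2\<close>.\<close>
    moreover have "0 \<le> (norm x - K)\<^sup>2" by simp
    ultimately show ?thesis
      by (simp add: E_def power2_diff power2_norm_eq_inner[symmetric])
  qed
  define m where "m = Inf (range E)"
  have bdd: "bdd_below (range E)" using lower by (auto intro!: bdd_belowI)
  have m_le: "m \<le> E x" for x
    unfolding m_def by (intro cInf_lower bdd) auto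
  have "\<exists>x. E x < m + inverse (real (Suc n))" for n
    using cInf_lessD[of "range E" "m + inverse (real (Suc n))"] unfolding m_def by auto
  then obtain s where s: "\<And>n. E (s n) < m + inverse (real (Suc n))" by metis
  \<comment> \<open>The parallelogram law; the contributions of \<open>f\<close> cancel by
    linearity.\<close>
  have par: "(dist x z)\<^sup>2 = 2 * E x + 2 * E z - 4 * E ((1/2) *\<^sub>R (x + z))" for x z
    by (simp add: E_def dist_norm power2_norm_eq_inner inner_simps f.add f.scaleR inner_commute algebra_simps)
  have "Cauchy s"
  proof (rule metric_CauchyI)
    fix e :: real assume "0 < e"
    \<comment> \<open>Two values below \<open>m + e\<^sup>2 / 4\<close> and a midpoint value of at
      least \<open>m\<close> make the right-hand side of \<open>par\<close> smaller than
      \<open>e\<^sup>2\<close>.\<close>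
    then obtain N where N: "inverse (real (Suc N)) < e\<^sup>2 / 4"
      using reals_Archimedean[of "e\<^sup>2 / 4"] by auto
    have small: "E (s n) < m + e\<^sup>2 / 4" if "N \<le> n" for n
    proof -
      have "inverse (real (Suc n)) \<le> inverse (real (Suc N))" using that by simp
      with N s[of n] show ?thesis by linarith
    qed
    have "dist (s p) (s n) < e" if "N \<le> p" "N \<le> n" for p n
    proof (rule power_less_imp_less_base)
      show "(dist (s p) (s n))\<^sup>2 < e\<^sup>2"
        using par[of "s p" "s n"] small[OF that(1)] small[OF that(2)]
          m_le[of "(1/2) *\<^sub>R (s p + s n)"] by linarith
    qed (use \<open>0 < e\<close> in simp)
    then show "\<exists>M. \<forall>p\<ge>M. \<forall>n\<ge>M. dist (s p) (s n) < e" by blast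
  qed
  then obtain u where u: "s \<longlonglongrightarrow> u"
    using Cauchy_convergent_iff convergent_def by blast
  have "(\<lambda>n. E (s n)) \<longlonglongrightarrow> E u"
    unfolding E_def by (intro tendsto_intros u f.tendsto)
  moreover have "(\<lambda>n. m + inverse (real (Suc n))) \<longlonglongrightarrow> m + 0"
    by (intro tendsto_intros LIMSEQ_inverse_real_of_nat)
  ultimately have Eu: "E u \<le> m"
    using s by (intro LIMSEQ_le[of "\<lambda>n. E (s n)"]) (auto intro: less_imp_le)
  have "f x = x \<bullet> u" for x
  proof -
    \<comment> \<open>The polynomial in \<open>t\<close> is
      \<open>E (u + t *\<^sub>R x) - E u\<close>.\<close>
    have "0 \<le> (x \<bullet> x) * t\<^sup>2 + (2 * (x \<bullet> u - f x)) * t" for t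
      using order_trans[OF Eu m_le[of "u + t *\<^sub>R x"]]
      by (simp add: E_def inner_simps f.add f.scaleR inner_commute power2_eq_square algebra_simps)
    then have "2 * (x \<bullet> u - f x) = 0" by (rule linear_coeff_eq_0) simp
    then show ?thesis by simp
  qed
  then show thesis by (rule that)
qed

lemma adjoint_blinfun:
  fixes A :: "'x::{real_inner,complete_space} \<Rightarrow>\<^sub>L 'y::real_inner"
  shows "A x \<bullet> y = x \<bullet> adjoint (blinfun_apply A) y"
proof -
  have "\<exists>u. \<forall>x. A x \<bullet> y = x \<bullet> u" for y
  proof -
    have "bounded_linear (\<lambda>x. A x \<bullet> y)"
      by (intro bounded_linear_intros blinfun.bounded_linear_right)
    from riesz_representation[OF this] show ?thesis by metis
  qed
  then obtain B where "\<And>x y. A x \<bullet> y = x \<bullet> B y" by metis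
  moreover from this have "adjoint (blinfun_apply A) = B" by (intro adjoint_unique) simp
  ultimately show ?thesis by simp
qed

section \<open>Orthogonal projection onto a finite-dimensional span\<close>

lemma orthogonal_expansion_residual:
  fixes C :: "'a::real_inner set"
  assumes "finite C" "pairwise orthogonal C" "s \<in> span C"
  shows "orthogonal (z - (\<Sum>c\<in>C. (z \<bullet> c / (c \<bullet> c)) *\<^sub>R c)) s"
proof (rule orthogonal_to_span[OF assms(3)])
  fix d assume d: "d \<in> C"
  \<comment> \<open>Only the term \<open>c = d\<close> survives. It equals
    \<open>z \<bullet> d\<close> even for \<open>d = 0\<close>, so \<open>C\<close> may contain the
    zero vector.\<close>
  have "(\<Sum>c\<in>C. (z \<bullet> c / (c \<bullet> c)) * (c \<bullet> d)) = (\<Sum>c\<in>C. if c = d then z \<bullet> d else 0)"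
    using assms(2) d by (intro sum.cong) (auto simp: pairwise_def orthogonal_def)
  then show "orthogonal (z - (\<Sum>c\<in>C. (z \<bullet> c / (c \<bullet> c)) *\<^sub>R c)) d"
    using d assms(1) by (simp add: orthogonal_def inner_diff_left inner_sum_left)
qed

lemma orth_proj_span:
  fixes C :: "'a::real_inner set"
  assumes "finite C" "pairwise orthogonal C"
  shows "orth_proj (span C) z = (\<Sum>c\<in>C. (z \<bullet> c / (c \<bullet> c)) *\<^sub>R c)"
proof (rule orth_proj_eqI)
  show "(\<Sum>c\<in>C. (z \<bullet> c / (c \<bullet> c)) *\<^sub>R c) \<in> span C"
    by (intro span_sum span_scale) (rule span_base)
qed (use assms in \<open>auto intro: orthogonal_expansion_residual\<close>)

text \<open>Gram-Schmidt replaces \<open>B\<close> by an orthogonal set with the same span, whose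
  explicit expansion meets the description in \<open>orth_proj\<close>.\<close>

lemma
  fixes B :: "'a::real_inner set"
  assumes "finite B"
  shows orth_proj_in_span: "orth_proj (span B) z \<in> span B"
    and orth_proj_residual: "s \<in> span B \<Longrightarrow> orthogonal (z - orth_proj (span B) z) s"
proof -
  obtain C where C: "finite C" "span C = span B" "pairwise orthogonal C"
    using basis_orthogonal[OF assms] by blast
  note eq = orth_proj_span[OF C(1,3), unfolded C(2)]
  show "orth_proj (span B) z \<in> span B"
    unfolding eq unfolding C(2)[symmetric] by (intro span_sum span_scale) (rule span_base)
  show "s \<in> span B \<Longrightarrow> orthogonal (z - orth_proj (span B) z) s"
    unfolding eq unfolding C(2)[symmetric] by (rule orthogonal_expansion_residual[OF C(1,3)])
qed

lemma orth_proj_ident: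
  assumes "subspace S" "z \<in> S"
  shows "orth_proj S z = z"
  by (rule orth_proj_eqI) (use assms in \<open>auto simp: orthogonal_def\<close>)

lemma inner_orth_proj_span:
  assumes "finite B" "s \<in> span B"
  shows "s \<bullet> orth_proj (span B) z = s \<bullet> z"
  using orth_proj_residual[OF assms, of z]
  by (simp add: orthogonal_def inner_diff_left inner_commute[of s])

text \<open>Both sides of the adjoint identity equal the inner product of the two projections. This
  serves to remove the adjoint projector from the determinant condition.\<close>

lemma adjoint_orth_proj_span:
  assumes "finite B"
  shows "adjoint (orth_proj (span B)) = orth_proj (span B)"
proof (rule adjoint_unique, intro allI)
  fix x y
  show "orth_proj (span B) x \<bullet> y = x \<bullet> orth_proj (span B) y"
    using inner_orth_proj_span[OF assms orth_proj_in_span[OF assms, of x], of y]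
      inner_orth_proj_span[OF assms orth_proj_in_span[OF assms, of y], of x]
    by (simp add: inner_commute)
qed

section \<open>The inner product of X on finite-dimensional subspaces of V\<close>

lemma orthogonal_image_basis:
  fixes j :: "'v::real_vector \<Rightarrow> 'x::real_inner"
  assumes "linear j" "finite B"
  obtains C where "finite C" "pairwise orthogonal C" "j ` span B = span C"
  using basis_orthogonal[of "j ` B"] linear_span_image[OF assms(1), of B] assms(2)
  by (metis finite_imageI)

text \<open>A finite-dimensional Riesz theorem for the inner product pulled back along
  \<open>j\<close>. It represents \<mu> on Xh by an element of Xh, although \<mu> itself need not
  come from X.\<close>

lemma functional_as_pulled_back_inner:
  fixes j :: "'v::real_vector \<Rightarrow> 'x::real_inner" and g :: "'v \<Rightarrow> real"
  assumes "linear j" "inj j" "linear g" "finite B"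
  shows "\<exists>u\<in>span B. \<forall>w\<in>span B. g w = j u \<bullet> j w"
proof -
  interpret j: linear j by fact
  interpret g: linear g by fact
  obtain C where C: "finite C" "pairwise orthogonal C" "j ` span B = span C"
    using orthogonal_image_basis[OF assms(1,4)] by metis
  define k where "k = inv j"
  have jk: "j (k c) = c" if "c \<in> C" for c
  proof -
    have "c \<in> range j" using C(3) that span_base by blast
    then show ?thesis by (simp add: k_def f_inv_into_f)
  qed
  have "(\<Sum>c\<in>C. (g (k c) / (c \<bullet> c)) *\<^sub>R c) \<in> j ` span B"
    unfolding C(3) by (intro span_sum span_scale) (rule span_base)
  then obtain u where u: "u \<in> span B" "j u = (\<Sum>c\<in>C. (g (k c) / (c \<bullet> c)) *\<^sub>R c)"
    by force
  have "g w = j u \<bullet> j w" if "w \<in> span B" for w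
  proof -
    have "j w \<in> span C" using that C(3) by blast
    \<comment> \<open>A vector of the span is its own projection, hence equals its orthogonal
      expansion; injectivity of \<open>j\<close> then carries the expansion back to V, where
      \<open>g\<close> acts.\<close>
    then have "j w = (\<Sum>c\<in>C. (j w \<bullet> c / (c \<bullet> c)) *\<^sub>R c)"
      using orth_proj_ident[of "span C" "j w"] orth_proj_span[OF C(1,2), of "j w"] by simp
    also have "\<dots> = j (\<Sum>c\<in>C. (j w \<bullet> c / (c \<bullet> c)) *\<^sub>R k c)"
      by (simp add: j.sum j.scaleR jk)
    finally have "w = (\<Sum>c\<in>C. (j w \<bullet> c / (c \<bullet> c)) *\<^sub>R k c)"
      using \<open>inj j\<close> by (auto dest: injD)
    then have "g w = g (\<Sum>c\<in>C. (j w \<bullet> c / (c \<bullet> c)) *\<^sub>R k c)" by (rule arg_cong)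
    also have "\<dots> = (\<Sum>c\<in>C. (j w \<bullet> c / (c \<bullet> c)) * g (k c))"
      by (simp add: g.sum g.scaleR)
    also have "\<dots> = j u \<bullet> j w"
      unfolding u(2) inner_sum_left by (intro sum.cong) (simp_all add: inner_commute)
    finally show ?thesis .
  qed
  with u(1) show ?thesis by blast
qed

text \<open>The restricted projector is a finite sum of the rank-one maps sending \<open>v\<close>
  to a multiple of \<open>k c\<close>, with coefficient
  \<open>j v \<bullet> c / (c \<bullet> c)\<close>. Continuity of \<open>j\<close> makes each of
  them bounded in the norm of V, so \<open>onorm\<close> gives a genuine bound.\<close>

lemma
  fixes j :: "'v::real_normed_vector \<Rightarrow>\<^sub>L 'x::real_inner"
  assumes "inj (blinfun_apply j)" "finite B"
  defines "S \<equiv> span B"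
  shows restrict_to_V_orth_proj_in_span: "restrict_to_V j (orth_proj (blinfun_apply j ` S)) v \<in> S"
    and apply_restrict_to_V_orth_proj:
      "j (restrict_to_V j (orth_proj (blinfun_apply j ` S)) v) = orth_proj (blinfun_apply j ` S) (j v)"
    and bounded_linear_restrict_to_V_orth_proj:
      "bounded_linear (restrict_to_V j (orth_proj (blinfun_apply j ` S)))"
proof -
  have lin: "linear (blinfun_apply j)"
    by (rule bounded_linear.linear) (rule blinfun.bounded_linear_right)
  obtain C where C: "finite C" "pairwise orthogonal C" "blinfun_apply j ` S = span C"
    using orthogonal_image_basis[OF lin assms(2)] unfolding S_def by metis
  define k where "k = inv (blinfun_apply j)"
  have k: "k c \<in> S \<and> j (k c) = c" if "c \<in> C" for c
  proof -
    have "c \<in> blinfun_apply j ` S" using C(3) that span_base by blast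
    then show ?thesis using assms(1) by (auto simp: k_def inv_f_f)
  qed
  let ?R = "restrict_to_V j (orth_proj (blinfun_apply j ` S))"
  let ?s = "\<lambda>v. \<Sum>c\<in>C. (j v \<bullet> c / (c \<bullet> c)) *\<^sub>R k c"
  have js: "j (?s v) = orth_proj (blinfun_apply j ` S) (j v)" for v
    unfolding C(3) orth_proj_span[OF C(1,2)] using k
    by (simp add: blinfun.sum_right blinfun.scaleR_right)
  have R: "?R v = ?s v" for v
    unfolding restrict_to_V_def js[symmetric] using assms(1) by (rule inv_f_f)
  show "?R v \<in> S"
    unfolding R unfolding S_def by (intro span_sum span_scale) (use k S_def in blast)
  show "j (?R v) = orth_proj (blinfun_apply j ` S) (j v)"
    unfolding R by (rule js)
  have "bounded_linear (\<lambda>v. (1 / (c \<bullet> c)) *\<^sub>R ((j v \<bullet> c) *\<^sub>R k c))" for c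
    by (intro bounded_linear_intros blinfun.bounded_linear_right)
  then have "bounded_linear ?s"
    by (intro bounded_linear_sum) simp
  then show "bounded_linear ?R"
    unfolding R[abs_def] .
qed

section \<open>Unique solvability of the Galerkin equation\<close>

text \<open>Coefficients are indexed by \<open>'n\<close> rather than by vectors, so that a matrix
  can act on them even if \<open>b\<close> repeats values.\<close>

lemma span_range_family:
  fixes b :: "'n::finite \<Rightarrow> 'a::real_vector"
  assumes "z \<in> span (range b)"
  obtains c :: "real ^ 'n" where "z = (\<Sum>i\<in>UNIV. (c $ i) *\<^sub>R b i)"
proof -
  have "\<exists>c :: real ^ 'n. z = (\<Sum>i\<in>UNIV. (c $ i) *\<^sub>R b i)"
    using assms
  proof (induction rule: span_induct_alt)
    case base
    have "0 = (\<Sum>i\<in>UNIV. ((0 :: real ^ 'n) $ i) *\<^sub>R b i)" by simp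
    then show ?case by blast
  next
    case (step r x z)
    then obtain k c where "x = b k" "z = (\<Sum>i\<in>UNIV. ((c :: real ^ 'n) $ i) *\<^sub>R b i)" by blast
    moreover have "r *\<^sub>R b k = (\<Sum>i\<in>UNIV. ((r *\<^sub>R axis k 1 :: real ^ 'n) $ i) *\<^sub>R b i)"
      by (simp add: axis_def if_distrib[of "\<lambda>a. r * a"] if_distrib[of "\<lambda>a. a *\<^sub>R _"] cong: if_cong)
    ultimately have "r *\<^sub>R x + z = (\<Sum>i\<in>UNIV. ((r *\<^sub>R axis k 1 + c) $ i) *\<^sub>R b i)"
      by (simp add: scaleR_add_left sum.distrib)
    then show ?case by blast
  qed
  then show thesis using that by blast
qed

text \<open>The coordinates of \<open>z\<close> lie in the kernel of the transposed matrix, since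
  expanding \<open>T z \<bullet> x k\<close> sums over the row index; the determinant makes that
  kernel trivial.\<close>

lemma linear_eq_0_if_Gram_det_nonzero:
  fixes b :: "'n::finite \<Rightarrow> 'a::real_vector" and T :: "'a \<Rightarrow> 'x::real_inner" and x :: "'n \<Rightarrow> 'x"
  assumes "linear T" "det (\<chi> i k. T (b i) \<bullet> x k) \<noteq> 0"
    and "z \<in> span (range b)" "\<And>k. T z \<bullet> x k = 0"
  shows "z = 0"
proof -
  interpret T: linear T by fact
  let ?M = "\<chi> i k. T (b i) \<bullet> x k"
  obtain c where c: "z = (\<Sum>i\<in>UNIV. (c $ i) *\<^sub>R b i)"
    using span_range_family[OF assms(3)] .
  have "(transpose ?M *v c) $ k = T z \<bullet> x k" for k
    unfolding c
    by (simp add: T.sum T.scaleR inner_sum_left matrix_vector_mult_def transpose_def mult.commute)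
  then have "transpose ?M *v c = 0"
    by (simp add: vec_eq_iff assms(4))
  moreover have "invertible (transpose ?M)"
    using assms(2) by (simp add: invertible_det_nz)
  ultimately have "c = 0"
    using matrix_left_invertible_ker unfolding invertible_def by metis
  then show ?thesis by (simp add: c)
qed

text \<open>Existence: represent \<open>g\<close> on the trial space and pull the representer back
  through \<open>AV\<close>. Uniqueness: a difference of solutions is annihilated by all test
  vectors \<open>xb k\<close>, so the determinant forces it to be 0.\<close>

lemma galerkin_ex1:
  fixes j :: "'v::real_normed_vector \<Rightarrow> 'x::real_inner" and g :: "'v \<Rightarrow> real"
    and yb :: "'n::finite \<Rightarrow> 'y::real_vector" and xb :: "'n \<Rightarrow> 'v"
  assumes "linear j" "inj j" "linear g" "linear AV"
    and Xh: "AV ` span (range yb) = span (range xb)"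
    and det: "det (\<chi> i k. j (AV (yb i)) \<bullet> j (xb k)) \<noteq> 0"
  shows "\<exists>!\<phi>. \<phi> \<in> span (range yb) \<and> (\<forall>w\<in>span (range xb). j (AV \<phi>) \<bullet> j w = g w)"
proof (rule ex_ex1I)
  obtain u where u: "u \<in> span (range xb)" "\<And>w. w \<in> span (range xb) \<Longrightarrow> g w = j u \<bullet> j w"
    using functional_as_pulled_back_inner[OF assms(1-3), of "range xb"] by auto
  then obtain \<phi> where "\<phi> \<in> span (range yb)" "AV \<phi> = u"
    unfolding Xh[symmetric] by blast
  with u(2) show "\<exists>\<phi>. \<phi> \<in> span (range yb) \<and> (\<forall>w\<in>span (range xb). j (AV \<phi>) \<bullet> j w = g w)"
    by auto
next
  fix \<phi> \<psi>
  assume *: "\<phi> \<in> span (range yb) \<and> (\<forall>w\<in>span (range xb). j (AV \<phi>) \<bullet> j w = g w)"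
    "\<psi> \<in> span (range yb) \<and> (\<forall>w\<in>span (range xb). j (AV \<psi>) \<bullet> j w = g w)"
  have lin: "linear (\<lambda>q. j (AV q))"
    using linear_compose[OF assms(4,1)] by (simp add: o_def)
  have "j (AV (\<phi> - \<psi>)) \<bullet> j (xb k) = 0" for k
    using * span_base[of "xb k" "range xb"] by (simp add: linear_diff[OF lin] inner_diff_left)
  then have "\<phi> - \<psi> = 0"
    using * by (intro linear_eq_0_if_Gram_det_nonzero[OF lin det]) (auto intro: span_diff)
  then show "\<phi> = \<psi>" by simp
qed

section \<open>The error estimate\<close>

theorem theorem3:
  fixes j :: "'v::{real_inner,complete_space} \<Rightarrow>\<^sub>L 'x::{real_inner,complete_space}"
    and A :: "'x \<Rightarrow>\<^sub>L 'y::{real_inner,complete_space}"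
    and AV :: "'y \<Rightarrow>\<^sub>L 'v"
    and \<mu> :: "'v \<Rightarrow>\<^sub>L real"
    and y :: 'y and xstar :: 'v
    and yb :: "'n::finite \<Rightarrow> 'y" and xb :: "'n \<Rightarrow> 'v"
    and Yh :: "'y set" and Xh :: "'v set"
    and \<phi>h :: 'y
  assumes triple: "hilbert_triple j"
    and A_adjoint: "\<And>q. blinfun_apply j (AV q) = adjoint (blinfun_apply A) q"
    and xstar: "A (j xstar) = y"
    and Yh: "Yh = span (range yb)"
    and Xh: "Xh = blinfun_apply AV ` Yh" "Xh = span (range xb)"
    and det: "det (\<chi> i k. adjoint (blinfun_apply A) (adjoint (orth_proj Yh) (yb i)) \<bullet> j (xb k)) \<noteq> 0"
    and \<phi>h: "\<phi>h = (THE \<phi>. \<phi> \<in> Yh \<and>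
        (\<forall>w\<in>Xh. blinfun_apply (to_dual j (adjoint (blinfun_apply A) \<phi>) - \<mu>) w = 0))"
  shows "\<exists>C\<ge>0. \<forall>\<epsilon>>0. \<forall>y\<epsilon>. norm (y - y\<epsilon>) \<le> \<epsilon> \<longrightarrow>
      \<bar>\<mu> xstar - \<phi>h \<bullet> orth_proj Yh y\<epsilon>\<bar>
        \<le> infdist \<mu> ((\<lambda>q. to_dual j (adjoint (blinfun_apply A) q)) ` Yh)
            * (1 + onorm (restrict_to_V j (orth_proj (blinfun_apply j ` Xh))))
            * infdist xstar Xh
          + C * \<epsilon>"
proof -
  let ?D = "\<lambda>q. to_dual j (adjoint (blinfun_apply A) q)"
  let ?P = "restrict_to_V j (orth_proj (blinfun_apply j ` Xh))"
  have inj: "inj (blinfun_apply j)"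
    using triple by (simp add: hilbert_triple_def)
  have lin: "linear (blinfun_apply f)" for f :: "'a::real_normed_vector \<Rightarrow>\<^sub>L 'b::real_normed_vector"
    by (rule bounded_linear.linear) (rule blinfun.bounded_linear_right)
  have D: "?D q v = j (AV q) \<bullet> j v" for q v
    by (simp add: A_adjoint)
  have "adjoint (orth_proj Yh) (yb i) = yb i" for i
    unfolding Yh by (simp add: adjoint_orth_proj_span orth_proj_ident span_base)
  with det have det': "det (\<chi> i k. j (AV (yb i)) \<bullet> j (xb k)) \<noteq> 0"
    by (simp add: A_adjoint)
  \<comment> \<open>Unique solvability is what turns the \<open>THE\<close> term into an actual
    Galerkin solution.\<close>
  have "\<phi>h \<in> Yh \<and> (\<forall>w\<in>Xh. (?D \<phi>h - \<mu>) w = 0)"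
    unfolding \<phi>h
  proof (rule theI')
    have "AV ` span (range yb) = span (range xb)"
      using Xh Yh by simp
    from galerkin_ex1[OF lin inj lin lin this det', of \<mu>]
    show "\<exists>!\<phi>. \<phi> \<in> Yh \<and> (\<forall>w\<in>Xh. (?D \<phi> - \<mu>) w = 0)"
      unfolding Xh(2) Yh minus_blinfun.rep_eq D by simp
  qed
  then have \<phi>h_Yh: "\<phi>h \<in> Yh" and gal: "\<And>w. w \<in> Xh \<Longrightarrow> (\<mu> - ?D \<phi>h) w = 0"
    by (auto simp: minus_blinfun.rep_eq)
  have P_Xh: "?P v \<in> Xh" for v
    unfolding Xh(2) by (intro restrict_to_V_orth_proj_in_span inj) simp
  have jP: "j (?P v) = orth_proj (blinfun_apply j ` Xh) (j v)" for v
    unfolding Xh(2) by (intro apply_restrict_to_V_orth_proj inj) simp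
  have blP: "bounded_linear ?P"
    unfolding Xh(2) by (intro bounded_linear_restrict_to_V_orth_proj inj) simp
  have jXh: "blinfun_apply j ` Xh = span (blinfun_apply j ` range xb)"
    unfolding Xh(2) by (simp add: linear_span_image lin)
  have residual: "j w \<bullet> j (v - ?P v) = 0" if "w \<in> Xh" for v w
  proof -
    have "orthogonal (j v - orth_proj (blinfun_apply j ` Xh) (j v)) (j w)"
      unfolding jXh by (rule orth_proj_residual) (use that in \<open>auto simp: jXh[symmetric]\<close>)
    then show ?thesis
      by (simp add: blinfun.diff_right jP orthogonal_def inner_commute)
  qed
  have key: "\<bar>(\<mu> - ?D \<phi>h) xstar\<bar> \<le> dist \<mu> (?D q) * ((1 + onorm ?P) * dist xstar w)"
    if "q \<in> Yh" "w \<in> Xh" for q w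
  proof -
    let ?e = "xstar - w"
    have "AV q \<in> Xh" "AV \<phi>h \<in> Xh" using that \<phi>h_Yh Xh(1) by auto
    then have "?D q (?e - ?P ?e) = 0" "?D \<phi>h (?e - ?P ?e) = 0"
      unfolding D by (auto intro: residual)
    \<comment> \<open>The two arguments differ by \<open>w + ?P ?e\<close>, an element of
      \<open>Xh\<close>.\<close>
    moreover have "(\<mu> - ?D \<phi>h) xstar = (\<mu> - ?D \<phi>h) (?e - ?P ?e)"
      using gal[OF that(2)] gal[OF P_Xh[of ?e]] by (simp add: blinfun.diff_right)
    ultimately have "(\<mu> - ?D \<phi>h) xstar = (\<mu> - ?D q) (?e - ?P ?e)"
      by (simp only: minus_blinfun.rep_eq)
    then have "\<bar>(\<mu> - ?D \<phi>h) xstar\<bar> \<le> norm (\<mu> - ?D q) * norm (?e - ?P ?e)"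
      using norm_blinfun[of "\<mu> - ?D q" "?e - ?P ?e"] by simp
    also have "\<dots> \<le> norm (\<mu> - ?D q) * (norm ?e + onorm ?P * norm ?e)"
      using norm_triangle_ineq4[of ?e "?P ?e"] onorm[OF blP, of ?e]
      by (intro mult_left_mono) auto
    finally show ?thesis
      by (simp add: dist_norm algebra_simps)
  qed
  have P_ge: "0 \<le> 1 + onorm ?P"
    using onorm_pos_le[OF blP] by simp
  have ne: "Yh \<noteq> {}" "Xh \<noteq> {}"
    using \<phi>h_Yh Xh(1) by auto
  have main: "\<bar>(\<mu> - ?D \<phi>h) xstar\<bar> \<le> infdist \<mu> (?D ` Yh) * (1 + onorm ?P) * infdist xstar Xh"
  proof (rule le_mult_infdist)
    fix w assume w: "w \<in> Xh"
    \<comment> \<open>The infima are taken one after the other: first over \<open>q\<close> with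
      \<open>w\<close> fixed, then over \<open>w\<close>.\<close>
    have "\<bar>(\<mu> - ?D \<phi>h) xstar\<bar> \<le> ((1 + onorm ?P) * dist xstar w) * infdist \<mu> (?D ` Yh)"
      using key w P_ge ne by (intro le_mult_infdist) (auto simp: mult.commute)
    then show "\<bar>(\<mu> - ?D \<phi>h) xstar\<bar> \<le> infdist \<mu> (?D ` Yh) * (1 + onorm ?P) * dist xstar w"
      by (simp add: mult_ac)
  qed (use ne P_ge infdist_nonneg in \<open>auto intro: mult_nonneg_nonneg\<close>)
  show ?thesis
  \<comment> \<open>\<phi>h is determined before \<epsilon> and \<open>y\<epsilon>\<close> are
    chosen, so its norm is an admissible constant.\<close>
  proof (intro exI[of _ "norm \<phi>h"] conjI allI impI)
    fix \<epsilon> :: real and y\<epsilon> assume "norm (y - y\<epsilon>) \<le> \<epsilon>"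
    then have noise: "\<bar>\<phi>h \<bullet> (y - y\<epsilon>)\<bar> \<le> norm \<phi>h * \<epsilon>"
      by (meson Cauchy_Schwarz_ineq2 mult_left_mono norm_ge_zero order_trans)
    \<comment> \<open>Since \<phi>h lies in \<open>Yh\<close>, pairing with it does not see the
      projection.\<close>
    have "\<phi>h \<bullet> orth_proj Yh y\<epsilon> = \<phi>h \<bullet> y\<epsilon>"
      using \<phi>h_Yh unfolding Yh by (intro inner_orth_proj_span) auto
    moreover have "\<phi>h \<bullet> y = ?D \<phi>h xstar"
      using adjoint_blinfun[of A "j xstar" \<phi>h] xstar by (simp add: inner_commute)
    ultimately have "\<mu> xstar - \<phi>h \<bullet> orth_proj Yh y\<epsilon> = (\<mu> - ?D \<phi>h) xstar + \<phi>h \<bullet> (y - y\<epsilon>)"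
      by (simp add: minus_blinfun.rep_eq inner_diff_right)
    with main noise show "\<bar>\<mu> xstar - \<phi>h \<bullet> orth_proj Yh y\<epsilon>\<bar>
        \<le> infdist \<mu> (?D ` Yh) * (1 + onorm ?P) * infdist xstar Xh + norm \<phi>h * \<epsilon>"
      by linarith
  qed simp
qed

end
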